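(* Let $\alpha,a,b\in\mathbb R$ be such that $a,b>0$ and $\alpha>-1$. Let $f:(0,b]\to\mathbb R_+$ be a function of bounded variation on every closed subinterval of $(0,b]$ and let $g:[0,b]\to[0,a]$ be an increasing bijection. The function $f\circ g^{-1}:(0,a]\to\mathbb R_+$ is regularly varying at $0_+$ with index $\alpha>-1$ if and only if the following three conditions are satisfied: (1) $\displaystyle\int_0^b g(s)\,df(s)$ exists as an improper Riemann–Stieltjes integral at $0$; (2) $\displaystyle\lim_{v\downarrow0}f(v)g(v)=0$; (3) $\displaystyle\lim_{v\downarrow0}\frac1{f(v)g(v)}\int_0^v g(s)\,df(s)=\frac{\alpha}{1+\alpha}$.
   Context: $\mathbb R_+$ is the set of positive reals. A measurable function $h:(0,a]\to\mathbb R_+$ is regularly varying at $0_+$ (at $0$ from the right) with index $\alpha$ if $\lim_{x\downarrow0}h(\lambda x)/h(x)=\lambda^\alpha$ for all $\lambda\in\mathbb R_+$. The improper integral $\int_0^v$ is $\lim_{u\downarrow0}\int_u^v$ (existing as a finite limit). *)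

theory Defs
  imports "HOL-Analysis.Analysis"
begin

text \<open>
  Functions on \<open>(0, b]\<close> or \<open>[0, b]\<close> are total functions \<open>real \<Rightarrow> real\<close> of which only the values
  on the stated interval matter.  The members of a (tagged) division of \<open>{u..v}\<close> are nonempty
  compact intervals \<open>K = {Inf K..Sup K}\<close>; degenerate ones contribute \<open>0\<close> to the sums below.
\<close>

definition bounded_variation_on :: "real \<Rightarrow> real \<Rightarrow> (real \<Rightarrow> real) \<Rightarrow> bool" where
  "bounded_variation_on u v f \<longleftrightarrow>
     (\<exists>B. \<forall>d. d division_of {u..v} \<longrightarrow> (\<Sum>K\<in>d. \<bar>f (Sup K) - f (Inf K)\<bar>) \<le> B)"

text \<open>
  The Riemann--Stieltjes integral of \<open>g\<close> (the integrand) against \<open>f\<close> (the integrator) over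
  \<open>[u, v]\<close>, as the limit of the Riemann--Stieltjes sums when the mesh tends to \<open>0\<close>; the mesh is
  uniform, there is no gauge.
\<close>

definition has_RS_integral ::
    "(real \<Rightarrow> real) \<Rightarrow> (real \<Rightarrow> real) \<Rightarrow> real \<Rightarrow> real \<Rightarrow> real \<Rightarrow> bool" where
  "has_RS_integral g f u v I \<longleftrightarrow>
     (\<forall>\<epsilon>>0. \<exists>\<delta>>0. \<forall>p. p tagged_division_of {u..v} \<and> (\<forall>(x, K)\<in>p. Sup K - Inf K < \<delta>) \<longrightarrow>
        \<bar>(\<Sum>(x, K)\<in>p. g x * (f (Sup K) - f (Inf K))) - I\<bar> < \<epsilon>)"

definition RS_integrable ::
    "(real \<Rightarrow> real) \<Rightarrow> (real \<Rightarrow> real) \<Rightarrow> real \<Rightarrow> real \<Rightarrow> bool" where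
  "RS_integrable g f u v \<longleftrightarrow> (\<exists>I. has_RS_integral g f u v I)"

definition RS_integral ::
    "(real \<Rightarrow> real) \<Rightarrow> (real \<Rightarrow> real) \<Rightarrow> real \<Rightarrow> real \<Rightarrow> real" where
  "RS_integral g f u v = (THE I. has_RS_integral g f u v I)"

text \<open>The improper integral of \<open>g\<close> against \<open>f\<close> over \<open>(0, v]\<close>.\<close>

definition has_improper_RS_integral ::
    "(real \<Rightarrow> real) \<Rightarrow> (real \<Rightarrow> real) \<Rightarrow> real \<Rightarrow> real \<Rightarrow> bool" where
  "has_improper_RS_integral g f v I \<longleftrightarrow>
     (\<forall>u\<in>{0<..v}. RS_integrable g f u v) \<and>
     ((\<lambda>u. RS_integral g f u v) \<longlongrightarrow> I) (at_right 0)"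

definition improper_RS_integrable ::
    "(real \<Rightarrow> real) \<Rightarrow> (real \<Rightarrow> real) \<Rightarrow> real \<Rightarrow> bool" where
  "improper_RS_integrable g f v \<longleftrightarrow> (\<exists>I. has_improper_RS_integral g f v I)"

definition improper_RS_integral ::
    "(real \<Rightarrow> real) \<Rightarrow> (real \<Rightarrow> real) \<Rightarrow> real \<Rightarrow> real" where
  "improper_RS_integral g f v = (THE I. has_improper_RS_integral g f v I)"

text \<open>\<open>h\<close> is considered as a function on \<open>(0, a]\<close>; for fixed \<open>c > 0\<close>, the argument \<open>c * x\<close> lies in
  \<open>(0, a]\<close> for all small \<open>x > 0\<close>.\<close>

definition regularly_varying_at_0 :: "real \<Rightarrow> (real \<Rightarrow> real) \<Rightarrow> real \<Rightarrow> bool" where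
  "regularly_varying_at_0 a h \<alpha> \<longleftrightarrow>
     h \<in> borel_measurable (restrict_space borel {0<..a}) \<and>
     (\<forall>x\<in>{0<..a}. h x > 0) \<and>
     (\<forall>c>0. ((\<lambda>x. h (c * x) / h x) \<longlongrightarrow> c powr \<alpha>) (at_right 0))"

end

theory Submission
  imports Defs "HOL-Real_Asymp.Real_Asymp"
begin

text \<open>
  Put \<open>h = f \<circ> inv g\<close>.  Integration by parts and the substitution \<open>x = g s\<close> turn \<open>\<integral>\<^sub>u\<^sup>v g df\<close> into
  \<open>g v f v - g u f u - \<integral> h\<close> with the last integral over \<open>[g u, g v]\<close>.  With
  \<open>H x = \<integral>\<^sub>0\<^sup>x h\<close>, the three conditions say that \<open>H\<close> is finite, \<open>x h(x) \<rightarrow> 0\<close> and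
  \<open>H(x) / (x h(x)) \<rightarrow> 1 / (1 + \<alpha>)\<close>, and the claim becomes Karamata's theorem and its converse.  The direct
  half follows by dominated convergence from \<open>H(x) / (x h(x)) = \<integral>\<^sub>0\<^sup>1 h(x t) / h(x) dt\<close>, the
  dominating function coming from a Potter bound.
\<close>

subsection \<open>Riemann--Stieltjes integrals\<close>

text \<open>The converse half works with finite increments instead: bounds on
  \<open>x h(x) / H(x)\<close> give inequalities such as
  \<open>H s * (1 + \<kappa> * ln (t / s)) \<le> H t\<close>, and compounding these over finer and
  finer subdivisions produces powers of \<open>t / s\<close>. In the direct half, regular variation
  gives a limit for each ratio separately, whereas a dominating function needs one bound for all
  \<open>t\<close> in \<open>(0, 1]\<close>. Measurability of \<open>h\<close> provides the missing
  uniformity. The constant \<open>\<alpha> / (1 + \<alpha>)\<close> is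
  \<open>1 - 1 / (1 + \<alpha>)\<close>: dividing the by-parts formula on \<open>(0, v]\<close> by
  \<open>f v * g v\<close> leaves \<open>1 - H x / (x * h x)\<close> at \<open>x = g v\<close>. The
  bound \<open>\<alpha> > -1\<close> makes \<open>t powr \<alpha>\<close> integrable at
  \<open>0\<close> and the exponent \<open>1 + \<alpha>\<close> of \<open>H\<close>
  positive.\<close>

lemma bounded_variation_dominated:
  assumes bv: "bounded_variation_on u v f"
  obtains V where "\<And>c d. u \<le> c \<Longrightarrow> c \<le> d \<Longrightarrow> d \<le> v \<Longrightarrow> \<bar>f d - f c\<bar> \<le> V d - V c"
proof -
  define S where "S = (\<lambda>D. \<Sum>K\<in>D. \<bar>f (Sup K) - f (Inf K)\<bar>)"
  \<comment> \<open>The total variation function. Its increments dominate those of \<open>f\<close>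
    and, unlike absolute increments of \<open>f\<close>, telescope over a division.\<close>
  define V where "V = (\<lambda>x. SUP D\<in>{D. D division_of {u..x}}. S D)"
  have extend: "\<exists>E. E division_of {u..d} \<and> S E = S D + \<bar>f d - f c\<bar>"
    if D: "D division_of {u..c}" and cd: "u \<le> c" "c \<le> d" for D c d
  proof (cases "c = d")
    case False
    \<comment> \<open>The sum runs over a set of cells, so the new cell must not be in
      \<open>D\<close> already. A degenerate \<open>{c..c}\<close> could be, hence the separate case
      \<open>c = d\<close>.\<close>
    have "{c..d} \<notin> D"
    proof
      assume "{c..d} \<in> D"
      then have "{c..d} \<subseteq> {u..c}" using D by auto
      then show False using cd False by auto
    qed
    moreover have "insert {c..d} D division_of {u..d}"
    proof -
      have "{{c..d}} division_of {c..d}"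
        using division_of_self[of c d] cd by simp
      from division_disjoint_union[OF this D] have "insert {c..d} D division_of {c..d} \<union> {u..c}"
        using cd by simp
      also have "{c..d} \<union> {u..c} = {u..d}" using cd by auto
      finally show ?thesis .
    qed
    ultimately show ?thesis
      using cd division_of_finite[OF D] by (intro exI[of _ "insert {c..d} D"]) (simp add: S_def)
  qed (use D in auto)
  obtain B where B: "\<And>D. D division_of {u..v} \<Longrightarrow> S D \<le> B"
    using bv by (auto simp: bounded_variation_on_def S_def)
  have bdd: "bdd_above (S ` {D. D division_of {u..d}})" if d: "u \<le> d" "d \<le> v" for d
  proof (rule bdd_aboveI2)
    fix D assume "D \<in> {D. D division_of {u..d}}"
    then obtain E where "E division_of {u..v}" "S E = S D + \<bar>f v - f d\<bar>"
      using extend[of D d v] d by auto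
    then show "S D \<le> B" using B[of E] by simp
  qed
  show thesis
  proof
    fix c d assume cd: "u \<le> c" "c \<le> d" "d \<le> v"
    have "V c \<le> V d - \<bar>f d - f c\<bar>"
      unfolding V_def
    proof (rule cSUP_least)
      show "{D. D division_of {u..c}} \<noteq> {}"
        using division_of_self[of u c] cd by auto
      fix D assume "D \<in> {D. D division_of {u..c}}"
      then obtain E where E: "E division_of {u..d}" "S E = S D + \<bar>f d - f c\<bar>"
        using extend[of D c d] cd by auto
      have "S E \<le> (SUP D\<in>{D. D division_of {u..d}}. S D)"
        using E cd by (intro cSUP_upper bdd) auto
      then show "S D \<le> (SUP D\<in>{D. D division_of {u..d}}. S D) - \<bar>f d - f c\<bar>"
        using E by simp
    qed
    then show "\<bar>f d - f c\<bar> \<le> V d - V c" by simp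
  qed
qed

text \<open>Increments of \<open>\<Phi>\<close> and \<open>V\<close> telescope, so one cell at a
  time is enough. For small mesh, uniform continuity bounds the factor \<open>g d - g c\<close> by a
  fixed \<open>\<eta>\<close>, and the total error is at most
  \<open>\<eta> * (V v - V u)\<close>.\<close>

lemma has_RS_integral_if_dominated:
  assumes uv: "u \<le> v" and g: "continuous_on {u..v} g"
    and V: "\<And>c d. u \<le> c \<Longrightarrow> c \<le> d \<Longrightarrow> d \<le> v \<Longrightarrow> V c \<le> V d"
    and bound: "\<And>c x d. u \<le> c \<Longrightarrow> c \<le> x \<Longrightarrow> x \<le> d \<Longrightarrow> d \<le> v \<Longrightarrow>
      \<bar>g x * (f d - f c) - (\<Phi> d - \<Phi> c)\<bar> \<le> (g d - g c) * (V d - V c)"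
  shows "has_RS_integral g f u v (\<Phi> v - \<Phi> u)"
  unfolding has_RS_integral_def
proof (intro allI impI)
  fix \<epsilon> :: real assume "\<epsilon> > 0"
  \<comment> \<open>The summand \<open>1\<close> covers \<open>V v = V u\<close> and makes the final
    inequality strict.\<close>
  define \<eta> where "\<eta> = \<epsilon> / (V v - V u + 1)"
  have W: "0 \<le> V v - V u" using V uv by simp
  have \<eta>: "\<eta> > 0" "\<eta> * (V v - V u) < \<epsilon>"
    using \<open>\<epsilon> > 0\<close> W by (auto simp: \<eta>_def field_simps)
  have "uniformly_continuous_on {u..v} g"
    by (simp add: compact_uniformly_continuous g)
  then obtain \<delta> where \<delta>: "\<delta> > 0"
    "\<And>x y. x \<in> {u..v} \<Longrightarrow> y \<in> {u..v} \<Longrightarrow> dist y x < \<delta> \<Longrightarrow> dist (g y) (g x) < \<eta>"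
    using \<eta> unfolding uniformly_continuous_on_def by metis
  show "\<exists>\<delta>>0. \<forall>p. p tagged_division_of {u..v} \<and> (\<forall>(x, K)\<in>p. Sup K - Inf K < \<delta>) \<longrightarrow>
        \<bar>(\<Sum>(x, K)\<in>p. g x * (f (Sup K) - f (Inf K))) - (\<Phi> v - \<Phi> u)\<bar> < \<epsilon>"
  proof (intro exI[of _ \<delta>] conjI allI impI \<delta>(1))
    fix p assume p: "p tagged_division_of {u..v} \<and> (\<forall>(x, K)\<in>p. Sup K - Inf K < \<delta>)"
    have *: "\<bar>g x * (f (Sup K) - f (Inf K)) - (\<Phi> (Sup K) - \<Phi> (Inf K))\<bar>
        \<le> \<eta> * (V (Sup K) - V (Inf K))" if xK: "(x, K) \<in> p" for x K
    proof -
      obtain c d where K: "K = {c..d}"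
        using p xK by (metis box_real(2) tagged_division_ofD(4))
      have "x \<in> K" "K \<subseteq> {u..v}"
        using p xK by (auto dest: tagged_division_ofD)
      then have cd: "u \<le> c" "c \<le> x" "x \<le> d" "d \<le> v" using K by auto
      have "d - c < \<delta>" using p xK K cd by fastforce
      then have "g d - g c \<le> \<eta>"
        using \<delta>(2)[of c d] cd by (auto simp: dist_real_def)
      then have "(g d - g c) * (V d - V c) \<le> \<eta> * (V d - V c)"
        using V[of c d] cd by (intro mult_right_mono) auto
      with bound[of c x d] cd K show ?thesis by auto
    qed
    have "(\<Sum>(x, K)\<in>p. g x * (f (Sup K) - f (Inf K))) - (\<Phi> v - \<Phi> u)
        = (\<Sum>(x, K)\<in>p. g x * (f (Sup K) - f (Inf K)) - (\<Phi> (Sup K) - \<Phi> (Inf K)))"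
      using additive_tagged_division_1[OF uv, of p \<Phi>] p
      by (simp add: sum_subtractf split_def)
    also have "\<bar>\<dots>\<bar> \<le> (\<Sum>(x, K)\<in>p. \<eta> * (V (Sup K) - V (Inf K)))"
      by (rule order_trans[OF sum_abs]) (auto intro!: sum_mono *)
    also have "\<dots> = \<eta> * (V v - V u)"
      using additive_tagged_division_1[OF uv, of p V] p
      by (simp add: sum_distrib_left[symmetric] split_def)
    finally show "\<bar>(\<Sum>(x, K)\<in>p. g x * (f (Sup K) - f (Inf K))) - (\<Phi> v - \<Phi> u)\<bar> < \<epsilon>"
      using \<eta> by simp
  qed
qed

text \<open>Two limits are compared on a single division fine enough for both; Cousin's lemma for a
  constant gauge provides it.\<close>

lemma has_RS_integral_unique:
  assumes "has_RS_integral g f u v I" "has_RS_integral g f u v J"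
  shows "I = J"
proof (rule ccontr)
  assume "I \<noteq> J"
  then have e: "\<bar>I - J\<bar> / 2 > 0" by simp
  define R where "R = (\<lambda>p. \<Sum>(x, K)\<in>p. g x * (f (Sup K) - f (Inf K)))"
  obtain \<delta> where \<delta>: "\<delta> > 0" "\<And>p. p tagged_division_of {u..v} \<Longrightarrow>
      \<forall>(x, K)\<in>p. Sup K - Inf K < \<delta> \<Longrightarrow> \<bar>R p - I\<bar> < \<bar>I - J\<bar> / 2"
    using assms(1) e unfolding has_RS_integral_def R_def by meson
  obtain \<delta>' where \<delta>': "\<delta>' > 0" "\<And>p. p tagged_division_of {u..v} \<Longrightarrow>
      \<forall>(x, K)\<in>p. Sup K - Inf K < \<delta>' \<Longrightarrow> \<bar>R p - J\<bar> < \<bar>I - J\<bar> / 2"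
    using assms(2) e unfolding has_RS_integral_def R_def by meson
  \<comment> \<open>A cell inside a ball of radius \<open>r\<close> is shorter than
    \<open>2 * r\<close>, hence than both thresholds.\<close>
  define r where "r = min \<delta> \<delta>' / 3"
  have r: "r > 0" "2 * r < \<delta>" "2 * r < \<delta>'" using \<delta>(1) \<delta>'(1) by (auto simp: r_def)
  obtain p where p: "p tagged_division_of {u..v}" "(\<lambda>x. ball x r) fine p"
    using fine_division_exists_real[OF gauge_ball[OF r(1)]] by blast
  have small: "Sup K - Inf K < 2 * r" if xK: "(x, K) \<in> p" for x K
  proof -
    obtain c d where K: "K = {c..d}"
      using p xK by (metis box_real(2) tagged_division_ofD(4))
    have "x \<in> K" "K \<subseteq> ball x r"
      using p xK by (auto dest: tagged_division_ofD fineD)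
    moreover have "c \<le> d" "c \<in> K" "d \<in> K" using \<open>x \<in> K\<close> K by auto
    ultimately have "c \<le> d" "c \<in> ball x r" "d \<in> ball x r" using K by blast+
    then show ?thesis using K by (auto simp: dist_real_def)
  qed
  have "\<bar>R p - I\<bar> < \<bar>I - J\<bar> / 2" "\<bar>R p - J\<bar> < \<bar>I - J\<bar> / 2"
    using p r small by (fastforce intro!: \<delta>(2) \<delta>'(2))+
  moreover have "\<bar>I - J\<bar> \<le> \<bar>R p - I\<bar> + \<bar>R p - J\<bar>" by linarith
  ultimately have "\<bar>I - J\<bar> < \<bar>I - J\<bar> / 2 + \<bar>I - J\<bar> / 2"
    by (meson add_strict_mono le_less_trans)
  then show False by simp
qed

lemma RS_integral_eqI: "has_RS_integral g f u v I \<Longrightarrow> RS_integral g f u v = I"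
  unfolding RS_integral_def by (blast intro: the_equality has_RS_integral_unique)

lemma improper_RS_integral_eqI:
  assumes "has_improper_RS_integral g f v I"
  shows "improper_RS_integral g f v = I"
  unfolding improper_RS_integral_def
  using assms by (intro the_equality) (auto simp: has_improper_RS_integral_def intro: tendsto_unique[rotated])

text \<open>On a cell \<open>{c..d}\<close> with tag \<open>x\<close>, the error splits at
  \<open>g x\<close>: \<open>h\<close> is compared with the constant \<open>f c\<close> on
  \<open>{g c..g x}\<close> and with \<open>f d\<close> on \<open>{g x..g d}\<close>. Either
  comparison is off by at most \<open>V d - V c\<close>, even if \<open>f\<close> jumps inside the
  cell.\<close>

lemma has_RS_integral_by_parts:
  assumes uv: "u \<le> v" and bv: "bounded_variation_on u v f"
    and g: "continuous_on {u..v} g" "strict_mono_on {u..v} g"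
    and h: "\<And>t. t \<in> {u..v} \<Longrightarrow> h (g t) = f t"
  shows "h integrable_on {g u..g v}"
    and "h \<in> borel_measurable (restrict_space borel {g u..g v})"
    and "has_RS_integral g f u v (g v * f v - g u * f u - integral {g u..g v} h)"
proof -
  obtain V where V: "\<And>c d. u \<le> c \<Longrightarrow> c \<le> d \<Longrightarrow> d \<le> v \<Longrightarrow> \<bar>f d - f c\<bar> \<le> V d - V c"
    using bounded_variation_dominated[OF bv] by blast
  have mono: "g c \<le> g d" if "u \<le> c" "c \<le> d" "d \<le> v" for c d
    using that strict_mono_on_leD[OF g(2), of c d] by simp
  have onto: "\<exists>t. c \<le> t \<and> t \<le> d \<and> s = g t" if "u \<le> c" "c \<le> d" "d \<le> v" "g c \<le> s" "s \<le> g d" for c d s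
    using IVT'[of g c s d] that continuous_on_subset[OF g(1), of "{c..d}"] by auto
  define G where "G = inv_into {u..v} g"
  have G: "G (g t) = t" if "t \<in> {u..v}" for t
    unfolding G_def using that g(2) by (intro inv_into_f_f) (auto dest: strict_mono_on_imp_inj_on)
  have G_mono: "\<exists>p q. x = g p \<and> y = g q \<and> u \<le> p \<and> p \<le> q \<and> q \<le> v"
    if xy: "x \<in> {g u..g v}" "y \<in> {g u..g v}" "x \<le> y" for x y
  proof -
    obtain q where q: "u \<le> q" "q \<le> v" "y = g q" using onto[of u v y] xy uv by auto
    then show ?thesis using onto[of u q x] xy by auto
  qed
  \<comment> \<open>Jordan decomposition carried over to the range of \<open>g\<close>:
    \<open>h\<close> is the difference of these two increasing functions, hence integrable and
    Borel.\<close>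
  have "mono_on {g u..g v} (V \<circ> G)" "mono_on {g u..g v} (\<lambda>x. V (G x) - h x)"
  proof -
    have "V (G x) \<le> V (G y) \<and> V (G x) - h x \<le> V (G y) - h y"
      if xy: "x \<in> {g u..g v}" "y \<in> {g u..g v}" "x \<le> y" for x y
      using G_mono[OF xy] by (auto simp: G h) (use V in force)+
    then show "mono_on {g u..g v} (V \<circ> G)" "mono_on {g u..g v} (\<lambda>x. V (G x) - h x)"
      by (auto intro!: mono_onI)
  qed
  then have "(\<lambda>x. (V \<circ> G) x - (V (G x) - h x)) integrable_on {g u..g v}"
    and "(\<lambda>x. (V \<circ> G) x - (V (G x) - h x)) \<in> borel_measurable (restrict_space borel {g u..g v})"
    by - (intro integrable_diff integrable_on_mono_on borel_measurable_diff borel_measurable_mono_on_fnc;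
        assumption)+
  then show int: "h integrable_on {g u..g v}"
    and "h \<in> borel_measurable (restrict_space borel {g u..g v})" by simp_all
  define \<Phi> where "\<Phi> = (\<lambda>t. g t * f t - integral {g u..g t} h)"
  have sub: "h integrable_on {g c..g d}" if "u \<le> c" "d \<le> v" "c \<le> d" for c d
    using integrable_on_subinterval[OF int, of "g c" "g d"] mono[of u c] mono[of d v] that by auto
  have "has_RS_integral g f u v (\<Phi> v - \<Phi> u)"
  proof (rule has_RS_integral_if_dominated[OF uv g(1), of V])
    show "V c \<le> V d" if "u \<le> c" "c \<le> d" "d \<le> v" for c d
      using V[OF that] by linarith
    fix c x d assume cxd: "u \<le> c" "c \<le> x" "x \<le> d" "d \<le> v"
    have gs: "g u \<le> g c" "g c \<le> g x" "g x \<le> g d" using mono cxd by auto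
    have near: "\<bar>integral {g p..g q} h - (g q - g p) * f r\<bar> \<le> (g q - g p) * (V d - V c)"
      if pq: "c \<le> p" "p \<le> q" "q \<le> d" "r = c \<or> r = d" for p q r
    proof -
      have i: "h integrable_on {g p..g q}" using sub pq cxd by auto
      have "integral {g p..g q} h - (g q - g p) * f r = integral {g p..g q} (\<lambda>s. h s - f r)"
        using i mono[of p q] pq cxd by (subst integral_diff) auto
      also have "norm \<dots> \<le> integral {g p..g q} (\<lambda>s. V d - V c)"
      proof (rule integral_norm_bound_integral)
        show "(\<lambda>s. h s - f r) integrable_on {g p..g q}" using i by (intro integrable_diff) auto
        fix s assume "s \<in> {g p..g q}"
        then obtain t where t: "p \<le> t" "t \<le> q" "s = g t" using onto[of p q s] pq cxd by auto
        then show "norm (h s - f r) \<le> V d - V c"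
          using pq(4) h[of t] V[of c t] V[of t d] pq cxd by auto
      qed auto
      finally show ?thesis using mono[of p q] pq cxd by simp
    qed
    have "integral {g u..g d} h = integral {g u..g c} h + integral {g c..g x} h + integral {g x..g d} h"
      using gs Henstock_Kurzweil_Integration.integral_combine[of "g u" "g c" "g d" h] Henstock_Kurzweil_Integration.integral_combine[of "g c" "g x" "g d" h]
        sub[of u d] sub[of c d] cxd by auto
    then have "g x * (f d - f c) - (\<Phi> d - \<Phi> c) = (integral {g c..g x} h - (g x - g c) * f c)
        + (integral {g x..g d} h - (g d - g x) * f d)"
      by (simp add: \<Phi>_def algebra_simps)
    moreover have "(g d - g c) * (V d - V c) = (g x - g c) * (V d - V c) + (g d - g x) * (V d - V c)"
      by (simp add: algebra_simps)
    ultimately show "\<bar>g x * (f d - f c) - (\<Phi> d - \<Phi> c)\<bar> \<le> (g d - g c) * (V d - V c)"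
      using near[of c x c] near[of x d d] cxd by linarith
  qed
  then show "has_RS_integral g f u v (g v * f v - g u * f u - integral {g u..g v} h)"
    by (simp add: \<Phi>_def algebra_simps)
qed

subsection \<open>The converse of Karamata's theorem\<close>

text \<open>A discrete Gronwall argument: \<open>n\<close> equal steps compound to
  \<open>(1 + \<kappa> * (q - p) / n) ^ n\<close>, which tends to the exponential. The rate may be
  negative, which is how upper bounds are obtained later.\<close>

lemma exp_growth:
  fixes G :: "real \<Rightarrow> real"
  assumes pq: "p \<le> q"
    and G: "\<And>s d. p \<le> s \<Longrightarrow> 0 \<le> d \<Longrightarrow> s + d \<le> q \<Longrightarrow> G s * (1 + \<kappa> * d) \<le> G (s + d)"
  shows "G p * exp (\<kappa> * (q - p)) \<le> G q"
proof (rule tendsto_upperbound)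
  show "(\<lambda>n. G p * (1 + \<kappa> * (q - p) / real n) ^ n) \<longlonglongrightarrow> G p * exp (\<kappa> * (q - p))"
    by (intro tendsto_intros tendsto_exp_limit_sequentially)
  \<comment> \<open>For negative \<open>\<kappa>\<close> the factor of one step is positive only for
    large \<open>n\<close>; positivity allows multiplying the induction hypothesis by it.\<close>
  have "(\<lambda>n. 1 + \<kappa> * (q - p) / real n) \<longlonglongrightarrow> 1" by real_asymp
  then have "\<forall>\<^sub>F n in sequentially. 1 + \<kappa> * (q - p) / real n > 0"
    by (rule order_tendstoD) simp
  then show "\<forall>\<^sub>F n in sequentially. G p * (1 + \<kappa> * (q - p) / real n) ^ n \<le> G q"
    using eventually_gt_at_top[of 0]
  proof eventually_elim
    case (elim n)
    define d where "d = (q - p) / real n"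
    have d: "d \<ge> 0" "real n * d = q - p" "1 + \<kappa> * d > 0" using elim pq by (auto simp: d_def)
    have "G p * (1 + \<kappa> * d) ^ j \<le> G (p + real j * d)" if "j \<le> n" for j
      using that
    proof (induction j)
      case (Suc j)
      have le: "real (Suc j) * d \<le> real n * d" using Suc d by (intro mult_right_mono) auto
      have "G p * (1 + \<kappa> * d) ^ Suc j = (G p * (1 + \<kappa> * d) ^ j) * (1 + \<kappa> * d)" by simp
      also have "\<dots> \<le> G (p + real j * d) * (1 + \<kappa> * d)"
        using Suc d by (intro mult_right_mono) auto
      also have "\<dots> \<le> G (p + real j * d + d)"
        using d le by (intro G) (auto simp: algebra_simps)
      finally show ?case by (simp add: algebra_simps)
    qed simp
    from this[of n] d show ?case by (simp add: d_def)
  qed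
qed simp

lemma has_integral_const_divide:
  fixes x y :: real assumes "0 < x" "x \<le> y"
  shows "((\<lambda>t. C / t) has_integral C * ln (y / x)) {x..y}"
proof -
  have "((\<lambda>t. C / t) has_integral C * ln y - C * ln x) {x..y}"
    using assms by (intro fundamental_theorem_of_calculus)
      (auto intro!: derivative_eq_intros simp: has_real_derivative_iff_has_vector_derivative[symmetric])
  then show ?thesis using assms by (simp add: ln_div algebra_simps)
qed

text \<open>Karamata's converse: \<open>x h(x) / H(x) \<rightarrow> \<beta>\<close> says that \<open>ln H\<close> has slope close to \<open>\<beta>\<close> as a function of \<open>ln x\<close>.\<close>

lemma karamata_converse_growth:
  fixes h H :: "real \<Rightarrow> real"
  assumes "X > 0" "\<kappa> \<ge> 0" "\<mu> \<ge> 0"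
    and int: "\<And>x y. 0 < x \<Longrightarrow> x \<le> y \<Longrightarrow> y \<le> X \<Longrightarrow> (h has_integral H y - H x) {x..y}"
    and h: "\<And>x. 0 < x \<Longrightarrow> x \<le> X \<Longrightarrow> h x \<ge> 0"
    and lo: "\<And>x. 0 < x \<Longrightarrow> x \<le> X \<Longrightarrow> \<kappa> * H x \<le> x * h x"
    and hi: "\<And>x. 0 < x \<Longrightarrow> x \<le> X \<Longrightarrow> x * h x \<le> \<mu> * H x"
    and xy: "0 < x" "x \<le> y" "y \<le> X"
  shows "H x * (y / x) powr \<kappa> \<le> H y" "H y \<le> H x * (y / x) powr \<mu>"
proof -
  have mono: "H s \<le> H t" if "0 < s" "s \<le> t" "t \<le> X" for s t
    using has_integral_nonneg[OF int[OF that]] h that by auto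
  \<comment> \<open>Since \<open>H\<close> is increasing, \<open>H s\<close> or \<open>H t\<close>
    can replace \<open>H z\<close> throughout \<open>{s..t}\<close>. Then \<open>h z\<close> is
    compared with a multiple of \<open>1 / z\<close>, whose integral is
    \<open>ln (t / s)\<close>.\<close>
  have step: "H s * (1 + \<kappa> * ln (t / s)) \<le> H t" "H t * (1 - \<mu> * ln (t / s)) \<le> H s"
    if st: "0 < s" "s \<le> t" "t \<le> X" for s t
  proof -
    have "\<kappa> * H s * ln (t / s) \<le> H t - H s"
    proof (rule has_integral_le[OF has_integral_const_divide int])
      fix z assume z: "z \<in> {s..t}"
      have "\<kappa> * H s \<le> \<kappa> * H z" using mono[of s z] z st assms(2) by (intro mult_left_mono) auto
      then show "\<kappa> * H s / z \<le> h z" using lo[of z] z st by (auto simp: field_simps)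
    qed (use st in auto)
    then show "H s * (1 + \<kappa> * ln (t / s)) \<le> H t" by (simp add: algebra_simps)
    have "H t - H s \<le> \<mu> * H t * ln (t / s)"
    proof (rule has_integral_le[OF int has_integral_const_divide])
      fix z assume z: "z \<in> {s..t}"
      have "\<mu> * H z \<le> \<mu> * H t" using mono[of z t] z st assms(3) by (intro mult_left_mono) auto
      then show "h z \<le> \<mu> * H t / z" using hi[of z] z st by (auto simp: field_simps)
    qed (use st in auto)
    then show "H t * (1 - \<mu> * ln (t / s)) \<le> H s" by (simp add: algebra_simps)
  qed
  have y: "y > 0" using xy by simp
  have "H (exp (ln x)) * exp (\<kappa> * (ln y - ln x)) \<le> H (exp (ln y))"
  proof (rule exp_growth[where G = "\<lambda>s. H (exp s)"])
    fix s d assume "ln x \<le> s" "0 \<le> d" "s + d \<le> ln y"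
    then have "exp (s + d) \<le> y" "exp s \<le> exp (s + d)"
      using y by (auto simp: ln_ge_iff)
    then show "H (exp s) * (1 + \<kappa> * d) \<le> H (exp (s + d))"
      using step(1)[of "exp s" "exp (s + d)"] xy by (auto simp: exp_diff[symmetric])
  qed (use xy in auto)
  then show "H x * (y / x) powr \<kappa> \<le> H y"
    using xy y by (simp add: powr_def ln_div)
  \<comment> \<open>The second step inequality bounds the left value from below by the right one, so
    growth is run backwards from \<open>- ln y\<close> to \<open>- ln x\<close> at rate
    \<open>- \<mu>\<close>.\<close>
  have "H (exp (- (- ln y))) * exp ((- \<mu>) * (- ln x - (- ln y))) \<le> H (exp (- (- ln x)))"
  proof (rule exp_growth[where G = "\<lambda>s. H (exp (- s))"])
    fix s d assume sd: "- ln y \<le> s" "0 \<le> d" "s + d \<le> - ln x"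
    then have "- s \<le> ln y" by simp
    then have "exp (- s) \<le> y" "exp (- (s + d)) \<le> exp (- s)"
      using y sd by (auto simp: ln_ge_iff)
    then show "H (exp (- s)) * (1 + (- \<mu>) * d) \<le> H (exp (- (s + d)))"
      using step(2)[of "exp (- (s + d))" "exp (- s)"] xy by (auto simp: exp_diff[symmetric])
  qed (use xy in auto)
  then have "H y * exp (- (\<mu> * ln (y / x))) \<le> H x"
    using xy y by (simp add: ln_div algebra_simps)
  then show "H y \<le> H x * (y / x) powr \<mu>"
    using xy y by (simp add: powr_def exp_minus field_simps)
qed

text \<open>With \<open>\<psi> x = x * h x / H x\<close>, the ratio \<open>h (c * x) / h x\<close>
  equals \<open>\<psi> (c * x) / \<psi> x * (H (c * x) / H x) / c\<close>. The quotient of the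
  \<open>\<psi>\<close> tends to \<open>1\<close>, that of the \<open>H\<close> to
  \<open>c powr \<beta>\<close> by growth bounds with exponents around \<open>\<beta>\<close>, and
  the division by \<open>c\<close> lowers the exponent by one.\<close>

lemma karamata_converse:
  fixes h H :: "real \<Rightarrow> real"
  assumes "a > 0" "\<beta> > 0"
    and int: "\<And>x y. 0 < x \<Longrightarrow> x \<le> y \<Longrightarrow> y \<le> a \<Longrightarrow> (h has_integral H y - H x) {x..y}"
    and h: "\<And>x. 0 < x \<Longrightarrow> x \<le> a \<Longrightarrow> h x > 0"
    and lim: "((\<lambda>x. H x / (x * h x)) \<longlongrightarrow> 1 / \<beta>) (at_right 0)"
    and "c > 0"
  shows "((\<lambda>x. h (c * x) / h x) \<longlongrightarrow> c powr (\<beta> - 1)) (at_right 0)"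
proof -
  have scale: "filterlim (\<lambda>x. c * x) (at_right 0) (at_right (0::real))" if "c > 0" for c
    using that by real_asymp
  have small: "\<forall>\<^sub>F x in at_right 0. 0 < x \<and> x \<le> X" if "X > 0" for X :: real
    using eventually_at_right_real[OF that] by eventually_elim auto
  define \<psi> where "\<psi> = (\<lambda>x. x * h x / H x)"
  have "((\<lambda>x. inverse (H x / (x * h x))) \<longlongrightarrow> inverse (1 / \<beta>)) (at_right 0)"
    using lim \<open>\<beta> > 0\<close> by (intro tendsto_inverse) auto
  then have \<psi>: "(\<psi> \<longlongrightarrow> \<beta>) (at_right 0)" by (simp add: \<psi>_def)
  \<comment> \<open>\<open>H\<close> is known only through its increments, so its sign near
    \<open>0\<close> is read off from the positive limit.\<close>
  have "\<forall>\<^sub>F x in at_right 0. H x / (x * h x) > 0"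
    using \<open>\<beta> > 0\<close> by (intro order_tendstoD(1)[OF lim]) auto
  then have pos: "\<forall>\<^sub>F x in at_right 0. H x > 0"
    using small[OF \<open>a > 0\<close>] by eventually_elim (auto simp: zero_less_divide_iff dest: h less_asym mult_pos_pos)
  have H1: "((\<lambda>x. H (c * x) / H x) \<longlongrightarrow> c powr \<beta>) (at_right 0)" if "c \<ge> 1" for c
  proof -
    have "\<forall>\<^sub>F x in at_right 0. c powr \<kappa> \<le> H (c * x) / H x \<and> H (c * x) / H x \<le> c powr \<mu>"
      if "0 \<le> \<kappa>" "\<kappa> < \<beta>" "\<beta> < \<mu>" for \<kappa> \<mu>
    proof -
      have "\<forall>\<^sub>F x in at_right 0. H x > 0 \<and> \<kappa> < \<psi> x \<and> \<psi> x < \<mu>"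
        using pos order_tendstoD[OF \<psi>] that by (intro eventually_conj) auto
      then obtain X0 where X0: "X0 > 0" "\<And>x. 0 < x \<Longrightarrow> x < X0 \<Longrightarrow> H x > 0 \<and> \<kappa> < \<psi> x \<and> \<psi> x < \<mu>"
        by (auto simp: eventually_at_right_field)
      define X where "X = min a (X0 / 2)"
      have X: "X > 0" "X \<le> a" "X < X0" using X0 \<open>a > 0\<close> by (auto simp: X_def)
      have H: "H x > 0" "\<kappa> * H x \<le> x * h x" "x * h x \<le> \<mu> * H x" if "0 < x" "x \<le> X" for x
        using X0(2)[of x] X that by (auto simp: \<psi>_def field_simps)
      have "\<forall>\<^sub>F x in at_right 0. 0 < x \<and> c * x \<le> X"
        using small[of "X / c"] X \<open>c \<ge> 1\<close> by (auto simp: field_simps)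
      then show ?thesis
      proof eventually_elim
        case (elim x)
        then have x: "0 < x" "x \<le> c * x" "c * x \<le> X" using \<open>c \<ge> 1\<close> by auto
        have le: "H x * (c * x / x) powr \<kappa> \<le> H (c * x)" "H (c * x) \<le> H x * (c * x / x) powr \<mu>"
        proof -
          have "h z \<ge> 0" if "0 < z" "z \<le> X" for z using h[of z] that X by auto
          note * = karamata_converse_growth[OF X(1) _ _ int this H(2,3) x]
          show "H x * (c * x / x) powr \<kappa> \<le> H (c * x)" "H (c * x) \<le> H x * (c * x / x) powr \<mu>"
            using * X that by auto
        qed
        have "H x > 0" using x by (intro H(1)) linarith+
        then show ?case using le x by (auto simp: field_simps)
      qed
    qed
    note ev = this
    have c0: "c > 0" using \<open>c \<ge> 1\<close> by simp
    have cl: "((\<lambda>e. c powr (\<beta> - e)) \<longlongrightarrow> c powr (\<beta> - 0)) (at_right 0)"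
      "((\<lambda>e. c powr (\<beta> + e)) \<longlongrightarrow> c powr (\<beta> + 0)) (at_right 0)"
      by (intro tendsto_intros; use c0 in simp)+
    show ?thesis
    \<comment> \<open>In each half only one exponent has to be close to \<open>\<beta>\<close>; the
      other one, \<open>\<beta> + 1\<close> or \<open>0\<close>, is any admissible value.\<close>
    proof (rule order_tendstoI)
      fix l assume "l < c powr \<beta>"
      then have "\<forall>\<^sub>F e in at_right 0. l < c powr (\<beta> - e)"
        using order_tendstoD(1)[OF cl(1), of l] by simp
      then have "\<forall>\<^sub>F e in at_right 0. l < c powr (\<beta> - e) \<and> 0 < e \<and> e \<le> \<beta>"
        using small[OF \<open>\<beta> > 0\<close>] by eventually_elim auto
      then obtain e where e: "l < c powr (\<beta> - e)" "0 < e" "e \<le> \<beta>"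
        by (metis (no_types, lifting) eventually_happens' trivial_limit_at_right_real)
      from ev[of "\<beta> - e" "\<beta> + 1"] e show "\<forall>\<^sub>F x in at_right 0. l < H (c * x) / H x"
        by (auto elim: eventually_mono)
    next
      fix l assume "c powr \<beta> < l"
      then have "\<forall>\<^sub>F e in at_right 0. c powr (\<beta> + e) < l"
        using order_tendstoD(2)[OF cl(2), of l] by simp
      then have "\<forall>\<^sub>F e in at_right 0. c powr (\<beta> + e) < l \<and> 0 < e"
        using small[OF \<open>\<beta> > 0\<close>] by eventually_elim auto
      then obtain e where e: "c powr (\<beta> + e) < l" "0 < e"
        by (metis (no_types, lifting) eventually_happens' trivial_limit_at_right_real)
      from ev[of 0 "\<beta> + e"] e \<open>\<beta> > 0\<close> show "\<forall>\<^sub>F x in at_right 0. H (c * x) / H x < l"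
        by (auto elim: eventually_mono)
    qed
  qed
  have H: "((\<lambda>x. H (c * x) / H x) \<longlongrightarrow> c powr \<beta>) (at_right 0)"
  proof (cases "c \<ge> 1")
    case False
    \<comment> \<open>The growth bounds compare \<open>x\<close> with a larger point. For
      \<open>c < 1\<close> the limit for \<open>1 / c\<close> is taken along \<open>c * x\<close>
      and inverted.\<close>
    then have "((\<lambda>x. H (1 / c * x) / H x) \<longlongrightarrow> (1 / c) powr \<beta>) (at_right 0)"
      using \<open>c > 0\<close> by (intro H1) auto
    from tendsto_inverse[OF filterlim_compose[OF this scale[OF \<open>c > 0\<close>]]]
    show ?thesis using \<open>c > 0\<close> by (simp add: powr_divide)
  qed (rule H1)
  have "((\<lambda>x. \<psi> (c * x) / \<psi> x * (H (c * x) / H x) / c) \<longlongrightarrow> \<beta> / \<beta> * c powr \<beta> / c) (at_right 0)"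
    using filterlim_compose[OF \<psi> scale[OF \<open>c > 0\<close>]] \<open>c > 0\<close> \<open>\<beta> > 0\<close>
    by (intro tendsto_intros H \<psi>) auto
  also have "\<beta> / \<beta> * c powr \<beta> / c = c powr (\<beta> - 1)"
    using \<open>c > 0\<close> \<open>\<beta> > 0\<close> by (simp add: powr_diff)
  finally show ?thesis
  proof (rule Lim_transform_eventually)
    show "\<forall>\<^sub>F x in at_right 0. \<psi> (c * x) / \<psi> x * (H (c * x) / H x) / c = h (c * x) / h x"
      using pos small[OF \<open>a > 0\<close>] eventually_compose_filterlim[OF pos scale[OF \<open>c > 0\<close>]]
    proof eventually_elim
      case (elim x)
      then show ?case using h[of x] \<open>c > 0\<close> by (simp add: \<psi>_def field_simps)
    qed
  qed
qed

subsection \<open>Karamata's theorem\<close>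

text \<open>Pointwise convergence gives convergence in measure of \<open>y \<mapsto> k (s + y) - k s\<close> on \<open>{0..2}\<close>; for
  large \<open>s\<close> the bad sets of \<open>s\<close> and of \<open>s + u\<close> are then too small to cover \<open>{u..2}\<close>.\<close>

lemma uniform_convergence_unit_interval:
  fixes k :: "real \<Rightarrow> real"
  assumes k [measurable]: "k \<in> borel_measurable borel"
    and lim: "\<And>u. ((\<lambda>s. k (s + u) - k s) \<longlongrightarrow> 0) at_top"
    and "\<epsilon> > 0"
  obtains S where "\<And>s u. s \<ge> S \<Longrightarrow> u \<in> {0..1} \<Longrightarrow> \<bar>k (s + u) - k s\<bar> < \<epsilon>"
proof -
  \<comment> \<open>Half of \<open>\<epsilon>\<close> is allowed for each of the two increments that
    make up \<open>k (s + u) - k s\<close>. The window \<open>{0..2}\<close> leaves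
    \<open>{u..2}\<close> with length at least \<open>1\<close> for every \<open>u\<close> in
    \<open>{0..1}\<close>.\<close>
  define E where "E = (\<lambda>s. {y \<in> {0..2}. \<epsilon> / 2 \<le> \<bar>k (s + y) - k s\<bar>})"
  have E_sets [measurable]: "E s \<in> sets borel" for s
    unfolding E_def by measurable
  have "((\<lambda>s. LINT y|lborel. indicat_real (E s) y) \<longlongrightarrow> integral\<^sup>L lborel (\<lambda>_ :: real. 0)) at_top"
  proof (rule integral_dominated_convergence_at_top[where s = "\<lambda>s. indicat_real (E s)"
        and f = "\<lambda>_. 0" and w = "indicat_real {0..2}"])
    show "AE y in lborel. ((\<lambda>s. indicat_real (E s) y) \<longlongrightarrow> 0) at_top"
    proof (intro AE_I2 tendsto_eventually)
      fix y :: real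
      have "\<forall>\<^sub>F s in at_top. \<bar>k (s + y) - k s\<bar> < \<epsilon> / 2"
        using tendstoD[OF lim[of y], of "\<epsilon> / 2"] \<open>\<epsilon> > 0\<close> by (simp add: dist_real_def)
      then show "\<forall>\<^sub>F s in at_top. indicat_real (E s) y = 0"
        by eventually_elim (auto simp: E_def)
    qed
  qed (auto simp: E_def split: split_indicator)
  then have "((\<lambda>s. measure lborel (E s)) \<longlongrightarrow> 0) at_top" by simp
  then have "\<forall>\<^sub>F s in at_top. measure lborel (E s) < 1 / 2"
    by (rule order_tendstoD) simp
  then obtain S where S: "\<And>s. s \<ge> S \<Longrightarrow> measure lebesgue (E s) < 1 / 2"
    by (auto simp: eventually_at_top_linorder measure_completion)
  show thesis
  proof (rule that[of S], rule ccontr)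
    fix s u :: real assume s: "s \<ge> S" and u: "u \<in> {0..1}" and "\<not> \<bar>k (s + u) - k s\<bar> < \<epsilon>"
    then have big: "\<epsilon> \<le> \<bar>k (s + u) - k s\<bar>" by simp
    have cover: "{u..2} \<subseteq> E s \<union> (+) u ` E (s + u)"
    proof
      fix z assume z: "z \<in> {u..2}"
      have "\<epsilon> / 2 \<le> \<bar>k (s + z) - k s\<bar> \<or> \<epsilon> / 2 \<le> \<bar>k (s + u + (z - u)) - k (s + u)\<bar>"
        using big by (auto simp: add.assoc abs_if split: if_splits)
      moreover have "z \<in> {0..2}" "z - u \<in> {0..2}" "z = u + (z - u)" using z u by auto
      ultimately show "z \<in> E s \<union> (+) u ` E (s + u)"
        unfolding E_def by blast
    qed
    have lm: "E t \<in> lmeasurable" for t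
    proof (rule bounded_set_imp_lmeasurable)
      show "bounded (E t)" by (rule bounded_subset[of "{0..2}"]) (auto simp: E_def)
      show "E t \<in> sets lebesgue" by (intro sets_completionI_sets) (simp add: E_sets)
    qed
    have "measure lebesgue {u..2} \<le> measure lebesgue (E s \<union> (+) u ` E (s + u))"
      using lm by (intro measure_mono_fmeasurable cover fmeasurable.Un measurable_translation) auto
    also have "\<dots> \<le> measure lebesgue (E s) + measure lebesgue ((+) u ` E (s + u))"
      using lm by (intro measure_Un_le fmeasurableD measurable_translation)
    also have "\<dots> < 1"
      using S[of s] S[of "s + u"] s u by (simp add: measure_translation)
    finally show False using u by simp
  qed
qed

text \<open>After removal of the linear part, increments over shifts in \<open>{0..1}\<close> are
  eventually below \<open>\<epsilon>\<close> uniformly. A shift \<open>u\<close> is a chain of at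
  most \<open>\<lceil>u\<rceil> \<le> u + 1\<close> such increments.\<close>

lemma potter_bound_additive:
  fixes k :: "real \<Rightarrow> real"
  assumes [measurable]: "k \<in> borel_measurable borel"
    and lim: "\<And>u. u \<ge> 0 \<Longrightarrow> ((\<lambda>s. k (s + u) - k s) \<longlongrightarrow> \<rho> * u) at_top"
    and "\<epsilon> > 0"
  shows "\<exists>S. \<forall>s\<ge>S. \<forall>u\<ge>0. \<bar>k (s + u) - k s - \<rho> * u\<bar> \<le> \<epsilon> * (u + 1)"
proof -
  define l where "l = (\<lambda>s. k s - \<rho> * s)"
  have l0: "((\<lambda>s. l (s + u) - l s) \<longlongrightarrow> 0) at_top" if "u \<ge> 0" for u
    using tendsto_diff[OF lim[OF that] tendsto_const[of "\<rho> * u"]] by (simp add: l_def algebra_simps)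
  have "((\<lambda>s. l (s + u) - l s) \<longlongrightarrow> 0) at_top" for u
  proof (cases "u \<ge> 0")
    case False
    have "filterlim (\<lambda>s. s + u) at_top at_top" by real_asymp
    from tendsto_minus[OF filterlim_compose[OF l0[of "- u"] this]] False
    show ?thesis by simp
  qed (rule l0)
  moreover have "l \<in> borel_measurable borel" unfolding l_def by measurable
  ultimately obtain S where S: "\<And>s u. s \<ge> S \<Longrightarrow> u \<in> {0..1} \<Longrightarrow> \<bar>l (s + u) - l s\<bar> < \<epsilon>"
    using uniform_convergence_unit_interval[of l \<epsilon>] \<open>\<epsilon> > 0\<close> by blast
  have iterate: "\<bar>l (s + u) - l s\<bar> \<le> \<epsilon> * real n" if "s \<ge> S" "0 \<le> u" "u \<le> real n" for s u n
    using that
  proof (induction n arbitrary: s u)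
    case (Suc n)
    define v where "v = min u 1"
    have v: "v \<in> {0..1}" "0 \<le> u - v" "u - v \<le> real n" using Suc.prems by (auto simp: v_def)
    have "\<bar>l (s + v + (u - v)) - l (s + v)\<bar> \<le> \<epsilon> * real n"
      using Suc.prems v by (intro Suc.IH) auto
    moreover have "\<bar>l (s + v) - l s\<bar> < \<epsilon>" using S[of s v] v Suc.prems by auto
    ultimately show ?case by (simp add: algebra_simps)
  qed simp
  show ?thesis
  proof (intro exI[of _ S] allI impI)
    fix s u :: real assume su: "s \<ge> S" "u \<ge> 0"
    have "\<bar>l (s + u) - l s\<bar> \<le> \<epsilon> * real (nat \<lceil>u\<rceil>)"
      using su by (intro iterate) (auto simp: real_nat_ceiling_ge)
    also have "\<dots> \<le> \<epsilon> * (u + 1)"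
      using su \<open>\<epsilon> > 0\<close> by (intro mult_left_mono) linarith+
    finally show "\<bar>k (s + u) - k s - \<rho> * u\<bar> \<le> \<epsilon> * (u + 1)"
      by (simp add: l_def algebra_simps)
  qed
qed

lemma regularly_varying_borel_measurable:
  assumes "regularly_varying_at_0 a h \<alpha>"
  shows "(\<lambda>x. if x \<in> {0<..a} then h x else 0) \<in> borel_measurable borel"
proof -
  have "h \<in> borel_measurable (restrict_space borel {0<..a})"
    using assms by (simp add: regularly_varying_at_0_def)
  then have "(\<lambda>x. indicat_real {0<..a} x *\<^sub>R h x) \<in> borel_measurable borel"
    by (subst (asm) borel_measurable_restrict_space_iff) auto
  then show ?thesis by (simp only: indicator_scaleR_eq_if)
qed

text \<open>With \<open>x = exp (- s)\<close> and \<open>t = exp (- u)\<close>, regular variation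
  says that increments of \<open>k = ln h\<close> over \<open>u\<close> tend to
  \<open>- \<alpha> * u\<close>, so the additive bound applies.\<close>

lemma potter_bound:
  assumes rv: "regularly_varying_at_0 a h \<alpha>" and "a > 0" "\<gamma> < \<alpha>"
  obtains X C where "0 < X" "X \<le> a" "\<And>x t. 0 < x \<Longrightarrow> x \<le> X \<Longrightarrow> 0 < t \<Longrightarrow> t \<le> 1 \<Longrightarrow>
    h (x * t) / h x \<le> C * t powr \<gamma>"
proof -
  define h0 where "h0 = (\<lambda>x. if x \<in> {0<..a} then h x else 0)"
  have [measurable]: "h0 \<in> borel_measurable borel"
    unfolding h0_def using rv by (rule regularly_varying_borel_measurable)
  have h_pos: "h x > 0" if "0 < x" "x \<le> a" for x
    using rv that by (auto simp: regularly_varying_at_0_def)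
  define k where "k = (\<lambda>s. ln (h0 (exp (- s))))"
  have k: "k s = ln (h (exp (- s)))" if "s \<ge> - ln a" for s
  proof -
    have "exp (- s) \<le> a" using that \<open>a > 0\<close> by (simp add: ln_ge_iff[symmetric])
    then show ?thesis by (simp add: k_def h0_def)
  qed
  have k_lim: "((\<lambda>s. k (s + u) - k s) \<longlongrightarrow> (- \<alpha>) * u) at_top" if "u \<ge> 0" for u
  proof -
    have "filterlim (\<lambda>s. exp (- s)) (at_right 0) (at_top :: real filter)" by real_asymp
    moreover have "((\<lambda>x. h (exp (- u) * x) / h x) \<longlongrightarrow> exp (- u) powr \<alpha>) (at_right 0)"
      using rv by (simp add: regularly_varying_at_0_def)
    ultimately have "((\<lambda>s. h (exp (- u) * exp (- s)) / h (exp (- s))) \<longlongrightarrow> exp (- u) powr \<alpha>) at_top"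
      by (rule filterlim_compose[rotated])
    then have "((\<lambda>s. ln (h (exp (- u) * exp (- s)) / h (exp (- s)))) \<longlongrightarrow> ln (exp (- u) powr \<alpha>)) at_top"
      by (rule tendsto_ln) simp
    also have "ln (exp (- u) powr \<alpha>) = (- \<alpha>) * u" by (simp add: ln_powr)
    finally show ?thesis
    proof (rule Lim_transform_eventually)
      show "\<forall>\<^sub>F s in at_top. ln (h (exp (- u) * exp (- s)) / h (exp (- s))) = k (s + u) - k s"
        using eventually_ge_at_top[of "- ln a"]
      proof eventually_elim
        case (elim s)
        then have "exp (- s) \<le> a" "exp (- (s + u)) \<le> a"
          using \<open>a > 0\<close> that by (simp_all add: ln_ge_iff[symmetric])
        then have "h (exp (- s)) > 0" "h (exp (- (s + u))) > 0" using h_pos by auto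
        then show ?case
          using elim that by (simp add: k ln_div exp_add[symmetric] algebra_simps)
      qed
    qed
  qed
  have k_borel: "k \<in> borel_measurable borel" unfolding k_def by measurable
  have "\<alpha> - \<gamma> > 0" using \<open>\<gamma> < \<alpha>\<close> by simp
  \<comment> \<open>The slack \<open>\<alpha> - \<gamma>\<close> turns the slope
    \<open>- \<alpha>\<close> into \<open>- \<gamma>\<close>, which is the exponent
    \<open>\<gamma>\<close> of \<open>t\<close>; its constant part gives
    \<open>C = exp (\<alpha> - \<gamma>)\<close>.\<close>
  then have "\<exists>S. \<forall>s\<ge>S. \<forall>u\<ge>0. \<bar>k (s + u) - k s - (- \<alpha>) * u\<bar> \<le> (\<alpha> - \<gamma>) * (u + 1)"
    by (intro potter_bound_additive k_borel k_lim)
  then obtain S where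
    S: "\<forall>s\<ge>S. \<forall>u\<ge>0. \<bar>k (s + u) - k s - (- \<alpha>) * u\<bar> \<le> (\<alpha> - \<gamma>) * (u + 1)" ..
  define X where "X = min a (exp (- S))"
  show thesis
  proof (rule that[of X "exp (\<alpha> - \<gamma>)"])
    fix x t :: real assume x: "0 < x" "x \<le> X" and t: "0 < t" "t \<le> 1"
    define s u where "s = - ln x" and "u = - ln t"
    have xa: "x \<le> a" "x \<le> exp (- S)" using x by (auto simp: X_def)
    then have "ln x \<le> - S" using x by (metis ln_exp ln_mono exp_gt_zero)
    then have su: "s \<ge> S" "u \<ge> 0" using t by (auto simp: s_def u_def)
    have "x * t \<le> x" using x t by (simp add: mult_left_le)
    have "ln x \<le> ln a" using xa x by (simp add: ln_mono)
    then have sa: "s \<ge> - ln a" by (simp add: s_def)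
    have "x * t \<le> a" using \<open>x * t \<le> x\<close> xa by linarith
    then have pos: "h x > 0" "h (x * t) > 0" using h_pos x t xa by auto
    have "exp (- (s + u)) = x * t" using x t by (simp add: s_def u_def exp_add)
    then have "ln (h (x * t) / h x) = k (s + u) - k s"
      using k[of s] k[of "s + u"] sa su pos x by (simp add: ln_div s_def)
    also have "\<dots> \<le> (\<alpha> - \<gamma>) * (u + 1) - \<alpha> * u" using S[rule_format, OF su] by linarith
    also have "\<dots> = (\<alpha> - \<gamma>) + \<gamma> * ln t" by (simp add: u_def algebra_simps)
    finally have "exp (ln (h (x * t) / h x)) \<le> exp ((\<alpha> - \<gamma>) + \<gamma> * ln t)" by simp
    then show "h (x * t) / h x \<le> exp (\<alpha> - \<gamma>) * t powr \<gamma>"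
      using pos t by (simp add: exp_add powr_def)
  qed (use \<open>a > 0\<close> in \<open>auto simp: X_def\<close>)
qed

lemma karamata_direct:
  assumes rv: "regularly_varying_at_0 a h \<alpha>" and "a > 0" "\<alpha> > -1"
    and int: "\<And>x. 0 < x \<Longrightarrow> x \<le> a \<Longrightarrow> h integrable_on {x..a}"
  obtains H where "\<And>y. 0 < y \<Longrightarrow> y \<le> a \<Longrightarrow> ((\<lambda>u. integral {u..y} h) \<longlongrightarrow> H y) (at_right 0)"
    and "((\<lambda>x. x * h x) \<longlongrightarrow> 0) (at_right 0)"
    and "((\<lambda>x. H x / (x * h x)) \<longlongrightarrow> 1 / (1 + \<alpha>)) (at_right 0)"
proof -
  define h0 where "h0 = (\<lambda>x. if x \<in> {0<..a} then h x else 0)"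
  have [measurable]: "h0 \<in> borel_measurable borel"
    unfolding h0_def using rv by (rule regularly_varying_borel_measurable)
  have h_pos: "h x > 0" if "0 < x" "x \<le> a" for x
    using rv that by (auto simp: regularly_varying_at_0_def)
  \<comment> \<open>Below \<open>\<alpha>\<close> for the Potter bound, above \<open>-1\<close> so
    that the majorant \<open>C * t powr \<gamma>\<close> is integrable on
    \<open>{0..1}\<close>.\<close>
  obtain \<gamma> where \<gamma>: "-1 < \<gamma>" "\<gamma> < \<alpha>" using \<open>\<alpha> > -1\<close> dense by blast
  obtain X C where X: "0 < X" "X \<le> a" and potter:
    "\<And>x t. 0 < x \<Longrightarrow> x \<le> X \<Longrightarrow> 0 < t \<Longrightarrow> t \<le> 1 \<Longrightarrow> h (x * t) / h x \<le> C * t powr \<gamma>"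
    using potter_bound[OF rv \<open>a > 0\<close> \<gamma>(2)] by blast
  have small: "\<forall>\<^sub>F x in at_right 0. 0 < x \<and> x \<le> y" if "y > 0" for y :: real
    using eventually_at_right_real[OF that] by eventually_elim auto
  define F where "F = (\<lambda>x t. if t \<in> {0..1} then h0 (x * t) / h0 x else 0)"
  define w where "w = (\<lambda>t. if t \<in> {0..1} then C * t powr \<gamma> else 0)"
  define p where "p = (\<lambda>t. if t \<in> {0..1} then t powr \<alpha> else (0::real))"
  have [measurable]: "F x \<in> borel_measurable borel" "w \<in> borel_measurable borel" "p \<in> borel_measurable borel" for x
    unfolding F_def w_def p_def by measurable
  have powr_int: "integrable lborel (\<lambda>t. if t \<in> {0..1} then t powr \<delta> else (0::real))" if "\<delta> > -1" for \<delta>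
  proof -
    have "(\<lambda>t. t powr \<delta>) absolutely_integrable_on {0..1}"
      by (intro nonnegative_absolutely_integrable_1 integrable_on_powr_from_0 that) auto
    then have "integrable lebesgue (\<lambda>t. if t \<in> {0..1} then t powr \<delta> else (0::real))"
      unfolding set_integrable_def by (rule Bochner_Integration.integrable_cong[THEN iffD1, rotated -1]) auto
    then show ?thesis by (subst (asm) integrable_completion) auto
  qed
  have w_int: "integrable lborel w"
    using integrable_mult_right[OF powr_int[OF \<gamma>(1)], of C] by (simp add: w_def if_distrib cong: if_cong)
  have p_integral: "integral\<^sup>L lborel p = 1 / (1 + \<alpha>)"
  proof -
    have "(p has_integral integral\<^sup>L lborel p) UNIV"
      using powr_int[OF \<open>\<alpha> > -1\<close>] by (intro has_integral_integral_lborel) (simp add: p_def)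
    moreover have "(p has_integral 1 / (1 + \<alpha>)) UNIV"
      using has_integral_powr_from_0[OF \<open>\<alpha> > -1\<close>, of 1] unfolding p_def has_integral_restrict_UNIV
      by (simp add: add.commute)
    ultimately show ?thesis by (rule has_integral_unique)
  qed
  have F_bound: "norm (F x t) \<le> w t" if "0 < x" "x \<le> X" for x t
  proof (cases "0 < t \<and> t \<le> 1")
    case True
    then have "0 < x * t" "x * t \<le> a" using that X by (auto intro: order_trans[OF mult_left_le])
    then show ?thesis
      using True that X potter[of x t] h_pos[of x] h_pos[of "x * t"] by (simp add: F_def w_def h0_def)
  qed (auto simp: F_def w_def h0_def)
  \<comment> \<open>The substitution of \<open>x * t\<close> for the variable. At
    \<open>x = X\<close> it also yields integrability of \<open>h0\<close> up to \<open>0\<close>,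
    from which the limits \<open>H y\<close> exist.\<close>
  have F_int: "(h0 has_integral x * h x * integral\<^sup>L lborel (F x)) {0..x}" if x: "0 < x" "x \<le> X" for x
  proof -
    have "integrable lborel (F x)"
      by (rule Bochner_Integration.integrable_bound[OF w_int]) (use F_bound[OF x] in \<open>auto intro!: AE_I2 intro: order_trans[OF _ abs_ge_self]\<close>)
    then have "(F x has_integral integral\<^sup>L lborel (F x)) UNIV" by (rule has_integral_integral_lborel)
    then have "((\<lambda>t. h0 (x * t) / h0 x) has_integral integral\<^sup>L lborel (F x)) {0..1}"
      unfolding F_def has_integral_restrict_UNIV .
    then have "((\<lambda>t. h0 x * (h0 (x * t) / h0 x)) has_integral h0 x * integral\<^sup>L lborel (F x)) {0..1}"
      by (rule has_integral_mult_right)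
    then have "((\<lambda>t. h0 (x * t)) has_integral h x * integral\<^sup>L lborel (F x)) {0..1}"
      using x X h_pos[of x] by (simp add: h0_def)
    moreover have "(\<lambda>t. t / x) ` {0..x} = {0..1}" using x by (auto simp: image_divide_atLeastAtMost)
    ultimately show ?thesis
      using has_integral_stretch_real_iff[of x h0 "h x * integral\<^sup>L lborel (F x)" 0 x] x by (simp add: mult.assoc)
  qed
  have F_lim: "((\<lambda>x. integral\<^sup>L lborel (F x)) \<longlongrightarrow> 1 / (1 + \<alpha>)) (at_right 0)"
  proof -
    \<comment> \<open>Dominated convergence is applied as \<open>s\<close> tends to infinity, with
      \<open>x = exp (- s)\<close>, and the result is pulled back by
      \<open>s = - ln x\<close>.\<close>
    have e: "filterlim (\<lambda>s. exp (- s)) (at_right 0) (at_top :: real filter)" by real_asymp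
    have pt: "((\<lambda>x. F x t) \<longlongrightarrow> p t) (at_right 0)" for t
    proof (cases "0 < t \<and> t \<le> 1")
      case True
      have "((\<lambda>x. h (t * x) / h x) \<longlongrightarrow> t powr \<alpha>) (at_right 0)"
        using rv True by (simp add: regularly_varying_at_0_def)
      moreover have "\<forall>\<^sub>F x in at_right 0. h (t * x) / h x = F x t"
        using small[OF \<open>a > 0\<close>]
      proof eventually_elim
        case (elim x)
        then have "x * t \<le> a" using True by (auto intro: order_trans[OF mult_left_le])
        then show ?case using elim True by (simp add: F_def h0_def mult.commute)
      qed
      ultimately show ?thesis using True by (auto simp: p_def elim: Lim_transform_eventually)
    qed (auto simp: F_def p_def h0_def intro!: tendsto_eventually)
    have "((\<lambda>s. integral\<^sup>L lborel (F (exp (- s)))) \<longlongrightarrow> integral\<^sup>L lborel p) at_top"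
    proof (rule integral_dominated_convergence_at_top[OF _ _ w_int])
      show "AE t in lborel. ((\<lambda>s. F (exp (- s)) t) \<longlongrightarrow> p t) at_top"
        by (intro AE_I2 filterlim_compose[OF pt e])
      show "\<forall>\<^sub>F s in at_top. AE t in lborel. norm (F (exp (- s)) t) \<le> w t"
        using eventually_compose_filterlim[OF small[OF X(1)] e]
        by eventually_elim (intro AE_I2 F_bound, auto)
    qed auto
    moreover have "filterlim (\<lambda>x. - ln x) at_top (at_right (0::real))" by real_asymp
    ultimately have "((\<lambda>x. integral\<^sup>L lborel (F (exp (- (- ln x))))) \<longlongrightarrow> 1 / (1 + \<alpha>)) (at_right 0)"
      unfolding p_integral by (rule filterlim_compose)
    then show ?thesis
      by (rule Lim_transform_eventually) (use small[of 1] in \<open>auto elim!: eventually_mono\<close>)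
  qed
  define H where "H = (\<lambda>y. integral {0..y} h0)"
  show thesis
  proof (rule that[of H])
    fix y assume y: "0 < y" "y \<le> a"
    have "h0 integrable_on {X..a}"
      by (rule integrable_eq[OF int]) (use X in \<open>auto simp: h0_def\<close>)
    then have "h0 integrable_on {0..a}"
      using F_int[OF X(1) order_refl] X
      by (intro Henstock_Kurzweil_Integration.integrable_combine[of 0 X a]) (auto simp: integrable_on_def)
    then have "h0 integrable_on {0..y}" by (rule integrable_on_subinterval) (use y in auto)
    then have "continuous_on {0..y} (\<lambda>u. integral {u..y} h0)" by (rule indefinite_integral_continuous_1')
    then have "((\<lambda>u. integral {u..y} h0) \<longlongrightarrow> H y) (at 0 within {0..y})"
      using y by (auto simp: continuous_on_def H_def)
    then have "((\<lambda>u. integral {u..y} h0) \<longlongrightarrow> H y) (at_right 0)"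
      using y by (simp add: at_within_Icc_at_right)
    then show "((\<lambda>u. integral {u..y} h) \<longlongrightarrow> H y) (at_right 0)"
    proof (rule Lim_transform_eventually)
      show "\<forall>\<^sub>F u in at_right 0. integral {u..y} h0 = integral {u..y} h"
        using small[OF y(1)] by eventually_elim (use y in \<open>auto simp: h0_def intro!: integral_cong\<close>)
    qed
  next
    \<comment> \<open>The Potter bound with \<open>X\<close> as base point and
      \<open>t = x / X\<close> bounds \<open>x * h x\<close> by a multiple of
      \<open>(x / X) powr (1 + \<gamma>)\<close>, where \<open>1 + \<gamma> > 0\<close>.\<close>
    have "filterlim (\<lambda>x. x / X) (at_right 0) (at_right 0)" using X(1) by real_asymp
    moreover have "((\<lambda>t. X * h X * C * t powr (1 + \<gamma>)) \<longlongrightarrow> X * h X * C * 0) (at_right 0)"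
      using \<gamma> by (intro tendsto_mult_left) real_asymp
    ultimately have lim0: "((\<lambda>x. X * h X * C * (x / X) powr (1 + \<gamma>)) \<longlongrightarrow> 0) (at_right 0)"
      using filterlim_compose by fastforce
    show "((\<lambda>x. x * h x) \<longlongrightarrow> 0) (at_right 0)"
    proof (rule tendsto_sandwich[OF _ _ tendsto_const lim0])
      show "\<forall>\<^sub>F x in at_right 0. 0 \<le> x * h x"
        using small[OF \<open>a > 0\<close>] by eventually_elim (auto simp: h_pos less_imp_le)
      show "\<forall>\<^sub>F x in at_right 0. x * h x \<le> X * h X * C * (x / X) powr (1 + \<gamma>)"
        using small[OF X(1)]
      proof eventually_elim
        case (elim x)
        then have "h x \<le> h X * (C * (x / X) powr \<gamma>)"
          using potter[of X "x / X"] X h_pos[of X] by (simp add: field_simps)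
        then have "x * h x \<le> x * (h X * (C * (x / X) powr \<gamma>))"
          using elim by (intro mult_left_mono) auto
        then show ?case using elim X by (simp add: powr_add field_simps)
      qed
    qed
    show "((\<lambda>x. H x / (x * h x)) \<longlongrightarrow> 1 / (1 + \<alpha>)) (at_right 0)"
    proof (rule Lim_transform_eventually[OF F_lim])
      show "\<forall>\<^sub>F x in at_right 0. integral\<^sup>L lborel (F x) = H x / (x * h x)"
        using small[OF X(1)]
      proof eventually_elim
        case (elim x)
        then have "H x = x * h x * integral\<^sup>L lborel (F x)"
          unfolding H_def by (intro integral_unique F_int) auto
        then show ?case using elim h_pos[of x] X by simp
      qed
    qed
  qed
qed

subsection \<open>Regular variation and the Riemann--Stieltjes integral\<close>

text \<open>An increasing function that omits no value has no jump: the values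
  \<open>g t - e / 2\<close> and \<open>g t + e / 2\<close>, clipped to the range, are attained at
  \<open>p\<close> and \<open>q\<close>, and \<open>g\<close> stays between them on
  \<open>{p..q}\<close>.\<close>

lemma strict_mono_bij_continuous:
  fixes g :: "real \<Rightarrow> real"
  assumes mono: "strict_mono_on {c..d} g" and surj: "g ` {c..d} = {g c..g d}"
  shows "continuous_on {c..d} g"
  unfolding continuous_on_iff
proof (intro ballI allI impI)
  fix t e :: real assume t: "t \<in> {c..d}" and "e > 0"
  have le: "g x \<le> g y \<longleftrightarrow> x \<le> y" if "x \<in> {c..d}" "y \<in> {c..d}" for x y
    using strict_mono_on_less_eq[OF mono] that by blast
  have gt: "g c \<le> g t" "g t \<le> g d" using t le by auto
  have onto: "\<exists>s\<in>{c..d}. g s = y" if "g c \<le> y" "y \<le> g d" for y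
  proof -
    have "y \<in> g ` {c..d}" unfolding surj using that by simp
    then show ?thesis by blast
  qed
  obtain p where p: "p \<in> {c..d}" "g p = max (g c) (g t - e / 2)"
    using onto[of "max (g c) (g t - e / 2)"] gt \<open>e > 0\<close> by auto
  obtain q where q: "q \<in> {c..d}" "g q = min (g d) (g t + e / 2)"
    using onto[of "min (g d) (g t + e / 2)"] gt \<open>e > 0\<close> by auto
  have pc: "p = c \<or> p < t"
  proof (cases "g t - e / 2 \<le> g c")
    case True
    then show ?thesis using le[of p c] p t by auto
  next
    case False
    then show ?thesis using le[of t p] p t \<open>e > 0\<close> by auto
  qed
  have qd: "q = d \<or> t < q"
  proof (cases "g t + e / 2 \<ge> g d")
    case True
    then show ?thesis using le[of d q] q t by auto
  next
    case False
    then show ?thesis using le[of q t] q t \<open>e > 0\<close> by auto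
  qed
  \<comment> \<open>The default \<open>1\<close> occurs when \<open>p\<close> or \<open>q\<close> is
    an endpoint of \<open>{c..d}\<close> and imposes no restriction on that side.\<close>
  define \<delta> where "\<delta> = min (if p < t then t - p else 1) (if t < q then q - t else 1)"
  show "\<exists>\<delta>>0. \<forall>s\<in>{c..d}. dist s t < \<delta> \<longrightarrow> dist (g s) (g t) < e"
  proof (intro exI[of _ \<delta>] conjI ballI impI)
    fix s assume s: "s \<in> {c..d}" "dist s t < \<delta>"
    have "p \<le> s" "s \<le> q"
      using s pc qd by (auto simp: \<delta>_def dist_real_def split: if_splits)
    then have "g p \<le> g s" "g s \<le> g q" using le[of p s] le[of s q] p(1) q(1) s(1) by auto
    then have "g t - e / 2 \<le> g s" "g s \<le> g t + e / 2" unfolding p(2) q(2) by auto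
    then show "dist (g s) (g t) < e" unfolding dist_real_def using \<open>e > 0\<close> by linarith
  qed (auto simp: \<delta>_def)
qed

text \<open>Used for \<open>g\<close> and for its inverse, so that limits at \<open>0\<close> pass
  between \<open>v\<close> and \<open>x = g v\<close> in both directions.\<close>

lemma strict_mono_bij_filterlim_at_right_0:
  fixes g :: "real \<Rightarrow> real"
  assumes "d > 0" and mono: "strict_mono_on {0..d} g" and bij: "bij_betw g {0..d} {0..e}"
  shows "g 0 = 0" "g d = e" "continuous_on {0..d} g" "filterlim g (at_right 0) (at_right 0)"
proof -
  have surj: "g ` {0..d} = {0..e}" using bij by (rule bij_betw_imp_surj_on)
  have le: "g x \<le> g y" if "0 \<le> x" "x \<le> y" "y \<le> d" for x y
    using strict_mono_on_leD[OF mono, of x y] that by simp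
  have ends: "0 \<le> g 0" "g 0 \<le> e" "g d \<le> e"
    using bij_betwE[OF bij] \<open>d > 0\<close> by auto
  have "0 \<in> g ` {0..d}" "e \<in> g ` {0..d}" unfolding surj using ends by auto
  then obtain p q where "p \<in> {0..d}" "g p = 0" "q \<in> {0..d}" "g q = e" by force
  then show g0: "g 0 = 0" and gd: "g d = e"
    using le[of 0 p] le[of q d] ends by auto
  show cont: "continuous_on {0..d} g"
    using mono surj g0 gd by (intro strict_mono_bij_continuous) auto
  then have "(g \<longlongrightarrow> 0) (at_right 0)"
    using \<open>d > 0\<close> g0 by (auto simp: continuous_on_def at_within_Icc_at_right dest: bspec[of _ _ 0])
  moreover have "\<forall>\<^sub>F x in at_right 0. g x > 0"
    using eventually_at_right_real[OF \<open>d > 0\<close>]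
    by eventually_elim (use strict_mono_onD[OF mono, of 0] g0 in auto)
  ultimately show "filterlim g (at_right 0) (at_right 0)"
    unfolding filterlim_at by (auto elim: eventually_mono)
qed

theorem corollaryA7:
  fixes \<alpha> a b :: real and f g :: "real \<Rightarrow> real"
  assumes "a > 0" and "b > 0" and "\<alpha> > -1"
    and f_pos: "\<forall>x\<in>{0<..b}. f x > 0"
    and f_bv: "\<forall>u v. 0 < u \<and> u \<le> v \<and> v \<le> b \<longrightarrow> bounded_variation_on u v f"
    and g_mono: "strict_mono_on {0..b} g"
    and g_bij: "bij_betw g {0..b} {0..a}"
  shows "regularly_varying_at_0 a (f \<circ> inv_into {0..b} g) \<alpha> \<longleftrightarrow>
     improper_RS_integrable g f b \<and>
     ((\<lambda>v. f v * g v) \<longlongrightarrow> 0) (at_right 0) \<and>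
     ((\<lambda>v. 1 / (f v * g v) * improper_RS_integral g f v) \<longlongrightarrow> \<alpha> / (1 + \<alpha>)) (at_right 0)"
    (is "?rv \<longleftrightarrow> ?c1 \<and> ?c2 \<and> ?c3")
proof -
  define G where "G = inv_into {0..b} g"
  define h where "h = f \<circ> G"
  note g = strict_mono_bij_filterlim_at_right_0[OF \<open>b > 0\<close> g_mono g_bij]
  have G_bij: "bij_betw G {0..a} {0..b}" unfolding G_def by (rule bij_betw_inv_into[OF g_bij])
  have Gg: "G (g t) = t" if "t \<in> {0..b}" for t
    unfolding G_def by (rule bij_betw_inv_into_left[OF g_bij that])
  have gG: "g (G x) = x" if "x \<in> {0..a}" for x
    unfolding G_def by (rule bij_betw_inv_into_right[OF g_bij that])
  have G_in: "G x \<in> {0..b}" if "x \<in> {0..a}" for x using bij_betwE[OF G_bij] that by blast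
  have g_less: "g x < g y \<longleftrightarrow> x < y" if "x \<in> {0..b}" "y \<in> {0..b}" for x y
    using strict_mono_on_less[OF g_mono] that by blast
  have G_mono: "strict_mono_on {0..a} G"
    by (rule strict_mono_onI) (metis G_in gG g_less)
  note G = strict_mono_bij_filterlim_at_right_0[OF \<open>a > 0\<close> G_mono G_bij]
  have g_pos: "0 < g v \<and> g v \<le> a" if "0 < v" "v \<le> b" for v
    using that g(1,2) g_less[of 0 v] strict_mono_on_leD[OF g_mono, of v b] by auto
  have G_pos: "0 < G x \<and> G x \<le> b" if "0 < x" "x \<le> a" for x
    using that G(1) G_in[of x] strict_mono_onD[OF G_mono, of 0 x] by auto
  have hg: "h (g t) = f t" if "t \<in> {0..b}" for t using Gg[OF that] by (simp add: h_def)
  have h_pos: "h x > 0" if "0 < x" "x \<le> a" for x using G_pos[OF that] f_pos by (simp add: h_def)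
  have small: "\<forall>\<^sub>F x in at_right 0. 0 < x \<and> x \<le> y" if "y > 0" for y :: real
    using eventually_at_right_real[OF that] by eventually_elim auto

  have parts: "h integrable_on {g u..g v}" "h \<in> borel_measurable (restrict_space borel {g u..g v})"
      "has_RS_integral g f u v (g v * f v - g u * f u - integral {g u..g v} h)"
    if uv: "0 < u" "u \<le> v" "v \<le> b" for u v
  proof -
    have "{u..v} \<subseteq> {0..b}" using uv by auto
    note * = has_RS_integral_by_parts[OF uv(2) _ continuous_on_subset[OF g(3) this]
        monotone_on_subset[OF g_mono this], of f h]
    show "h integrable_on {g u..g v}" "h \<in> borel_measurable (restrict_space borel {g u..g v})"
      "has_RS_integral g f u v (g v * f v - g u * f u - integral {g u..g v} h)"
      using * f_bv hg uv by auto
  qed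
  have h_int: "h integrable_on {x..a}" and h_borel_x: "h \<in> borel_measurable (restrict_space borel {x..a})"
    if "0 < x" "x \<le> a" for x
    using parts(1,2)[of "G x" b] G_pos[OF that] gG[of x] g(2) that by auto
  \<comment> \<open>Bounded variation is available only away from \<open>0\<close>, so measurability
    is glued from countably many closed intervals.\<close>
  have h_borel: "h \<in> borel_measurable (restrict_space borel {0<..a})"
  proof (rule measurable_piecewise_restrict[where C = "range (\<lambda>n. {a / Suc n..a})"])
    show "space (restrict_space borel {0<..a}) \<subseteq> \<Union> (range (\<lambda>n. {a / Suc n..a}))"
    proof
      fix x assume "x \<in> space (restrict_space borel {0<..a})"
      then have x: "0 < x" "x \<le> a" by (auto simp: space_restrict_space)
      obtain n where "a / x < real n" using reals_Archimedean2 by blast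
      then have "a / Suc n \<le> x" using x by (simp add: field_simps)
      then show "x \<in> \<Union> (range (\<lambda>n. {a / Suc n..a}))" using x by auto
    qed
  next
    fix \<Omega> assume "\<Omega> \<in> range (\<lambda>n. {a / Suc n..a})"
    then obtain n where \<Omega>: "\<Omega> = {a / Suc n..a}" by auto
    have n: "0 < a / Suc n" "a / Suc n \<le> a" using \<open>a > 0\<close> by (auto simp: field_simps)
    then have sub: "\<Omega> \<subseteq> {0<..a}" using \<Omega> by auto
    show "\<Omega> \<inter> space (restrict_space borel {0<..a}) \<in> sets (restrict_space borel {0<..a})"
      using sub by (auto simp: sets_restrict_space_iff space_restrict_space \<Omega>)
    have "{0<..a} \<inter> \<Omega> = {a / Suc n..a}" using sub \<Omega> by auto
    then show "h \<in> borel_measurable (restrict_space (restrict_space borel {0<..a}) \<Omega>)"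
      using h_borel_x[OF n] by (subst restrict_restrict_space) (simp_all add: \<Omega>)
  qed simp

  have RS: "RS_integrable g f u v"
      "RS_integral g f u v = g v * f v - g u * f u - integral {g u..g v} h" if "0 < u" "u \<le> v" "v \<le> b" for u v
    using parts(3)[OF that] by (auto simp: RS_integrable_def RS_integral_eqI)
  \<comment> \<open>In the by-parts formula on \<open>{u..v}\<close> the boundary term at
    \<open>u\<close> vanishes by the second condition, and the integral of \<open>h\<close>
    converges to \<open>H (g v)\<close>.\<close>
  have improper: "has_improper_RS_integral g f v (g v * f v - H (g v))"
    if lim: "\<And>y. 0 < y \<Longrightarrow> y \<le> a \<Longrightarrow> ((\<lambda>x. integral {x..y} h) \<longlongrightarrow> H y) (at_right 0)"
      and fg: "((\<lambda>u. f u * g u) \<longlongrightarrow> 0) (at_right 0)" and v: "0 < v" "v \<le> b" for H v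
    unfolding has_improper_RS_integral_def
  proof
    have "((\<lambda>u. g v * f v - f u * g u - integral {g u..g v} h) \<longlongrightarrow> g v * f v - 0 - H (g v)) (at_right 0)"
      using g_pos[OF v] by (intro tendsto_intros fg filterlim_compose[OF lim g(4)]) auto
    then have "((\<lambda>u. g v * f v - f u * g u - integral {g u..g v} h) \<longlongrightarrow> g v * f v - H (g v)) (at_right 0)"
      by simp
    then show "((\<lambda>u. RS_integral g f u v) \<longlongrightarrow> g v * f v - H (g v)) (at_right 0)"
      by (rule Lim_transform_eventually)
        (use small[OF v(1)] v in \<open>auto elim!: eventually_mono simp: RS mult.commute\<close>)
  qed (use RS v in auto)
  have ratio: "\<forall>\<^sub>F v in at_right 0. 1 / (f v * g v) * improper_RS_integral g f v = 1 - H (g v) / (g v * h (g v))"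
    if "\<And>y. 0 < y \<Longrightarrow> y \<le> a \<Longrightarrow> ((\<lambda>x. integral {x..y} h) \<longlongrightarrow> H y) (at_right 0)"
      and "((\<lambda>u. f u * g u) \<longlongrightarrow> 0) (at_right 0)" for H
    using small[OF \<open>b > 0\<close>]
  proof eventually_elim
    case (elim v)
    then have "improper_RS_integral g f v = g v * f v - H (g v)"
      using that by (intro improper_RS_integral_eqI improper) auto
    moreover have "h (g v) = f v" "f v > 0" "g v > 0" using elim hg g_pos f_pos by auto
    ultimately show ?case by (simp add: field_simps)
  qed

  show ?thesis
  proof
    assume ?rv
    then have rv: "regularly_varying_at_0 a h \<alpha>" by (simp add: h_def G_def)
    obtain H where H: "\<And>y. 0 < y \<Longrightarrow> y \<le> a \<Longrightarrow> ((\<lambda>u. integral {u..y} h) \<longlongrightarrow> H y) (at_right 0)"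
        "((\<lambda>x. x * h x) \<longlongrightarrow> 0) (at_right 0)" "((\<lambda>x. H x / (x * h x)) \<longlongrightarrow> 1 / (1 + \<alpha>)) (at_right 0)"
      using karamata_direct[OF rv \<open>a > 0\<close> \<open>\<alpha> > -1\<close> h_int] by blast
    have c2: ?c2
      by (rule Lim_transform_eventually[OF filterlim_compose[OF H(2) g(4)]])
        (use small[OF \<open>b > 0\<close>] in \<open>auto elim!: eventually_mono simp: hg\<close>)
    moreover have ?c1
      unfolding improper_RS_integrable_def using improper[OF H(1) c2 \<open>b > 0\<close>] by blast
    moreover have ?c3
    proof -
      have "((\<lambda>v. 1 - H (g v) / (g v * h (g v))) \<longlongrightarrow> 1 - 1 / (1 + \<alpha>)) (at_right 0)"
        by (intro tendsto_intros filterlim_compose[OF H(3) g(4)])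
      moreover have "1 - 1 / (1 + \<alpha>) = \<alpha> / (1 + \<alpha>)" using \<open>\<alpha> > -1\<close> by (simp add: field_simps)
      ultimately show ?thesis
        using tendsto_cong[OF ratio[OF H(1) c2]] by simp
    qed
    ultimately show "?c1 \<and> ?c2 \<and> ?c3" by blast
  next
    assume conds: "?c1 \<and> ?c2 \<and> ?c3"
    then obtain I where I: "((\<lambda>u. RS_integral g f u b) \<longlongrightarrow> I) (at_right 0)"
      by (auto simp: improper_RS_integrable_def has_improper_RS_integral_def)
    \<comment> \<open>The by-parts formula on \<open>{u..b}\<close>, as \<open>u\<close> tends to
      \<open>0\<close>, identifies this as the integral of \<open>h\<close> over
      \<open>(0, a]\<close>.\<close>
    define L where "L = g b * f b - I"
    have "((\<lambda>u. g b * f b - f u * g u - RS_integral g f u b) \<longlongrightarrow> g b * f b - 0 - I) (at_right 0)"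
      using conds I by (intro tendsto_intros) auto
    from filterlim_compose[OF this G(4)]
    have J: "((\<lambda>x. integral {x..a} h) \<longlongrightarrow> L) (at_right 0)"
      unfolding L_def
      by (rule Lim_transform_eventually[OF tendsto_eq_rhs])
        (use small[OF \<open>a > 0\<close>] G_pos gG g(2) in \<open>auto elim!: eventually_mono simp: RS mult.commute\<close>)
    \<comment> \<open>Subtracting the tail from \<open>L\<close> gives a limit for every
      \<open>y\<close>. Hence the improper integrals over \<open>(0, v]\<close> in the third
      condition all exist, although the first condition concerns \<open>b\<close> alone.\<close>
    define H where "H = (\<lambda>y. L - integral {y..a} h)"
    have H_int: "(h has_integral H y - H x) {x..y}" if "0 < x" "x \<le> y" "y \<le> a" for x y
    proof -
      have "h integrable_on {x..a}" using h_int that by simp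
      moreover from this have "h integrable_on {x..y}" by (rule integrable_on_subinterval) (use that in auto)
      ultimately show ?thesis
        using Henstock_Kurzweil_Integration.integral_combine[of x y a h] that
        by (simp add: H_def has_integral_iff)
    qed
    have H_lim: "((\<lambda>x. integral {x..y} h) \<longlongrightarrow> H y) (at_right 0)" if y: "0 < y" "y \<le> a" for y
      unfolding H_def
    proof (rule Lim_transform_eventually[OF tendsto_diff[OF J tendsto_const]])
      show "\<forall>\<^sub>F x in at_right 0. integral {x..a} h - integral {y..a} h = integral {x..y} h"
        using small[OF y(1)]
      proof eventually_elim
        case (elim x)
        then show ?case using integral_unique[OF H_int[of x y]] y by (simp add: H_def)
      qed
    qed
    have ratio_lim: "((\<lambda>x. H x / (x * h x)) \<longlongrightarrow> 1 / (1 + \<alpha>)) (at_right 0)"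
    proof -
      have "((\<lambda>v. 1 - H (g v) / (g v * h (g v))) \<longlongrightarrow> \<alpha> / (1 + \<alpha>)) (at_right 0)"
        using conds tendsto_cong[OF ratio[OF H_lim]] by blast
      from tendsto_diff[OF tendsto_const[of 1] filterlim_compose[OF this G(4)]]
      have "((\<lambda>x. H (g (G x)) / (g (G x) * h (g (G x)))) \<longlongrightarrow> 1 / (1 + \<alpha>)) (at_right 0)"
        using \<open>\<alpha> > -1\<close> by (simp add: field_simps)
      then show ?thesis
        by (rule Lim_transform_eventually)
          (use small[OF \<open>a > 0\<close>] gG in \<open>auto elim!: eventually_mono\<close>)
    qed
    \<comment> \<open>Here \<open>\<beta> = 1 + \<alpha>\<close>, so the exponent
      \<open>\<beta> - 1\<close> is \<open>\<alpha>\<close>.\<close>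
    have "((\<lambda>x. h (c * x) / h x) \<longlongrightarrow> c powr \<alpha>) (at_right 0)" if "c > 0" for c
      using karamata_converse[OF \<open>a > 0\<close> _ H_int h_pos ratio_lim that] \<open>\<alpha> > -1\<close> by simp
    then show ?rv
      using h_borel h_pos by (auto simp: regularly_varying_at_0_def h_def G_def)
  qed
qed

end
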